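(* Let $\mathbf{f}_f\in W^{1,1}(0,T;\mathbf{V}_f')$, $\mathbf{f}_p\in W^{1,1}(0,T;\mathbf{X}_p')$, $q_f\in W^{1,1}(0,T;W_f')$, $q_p\in W^{1,1}(0,T;W_p')$. If $(p_p(t),\boldsymbol{\sigma}_e(t))\in D$ solves $$\frac{d}{dt}\begin{pmatrix}p_p(t)\\ \boldsymbol{\sigma}_e(t)\end{pmatrix}+\mathcal{M}\begin{pmatrix}p_p(t)\\ \boldsymbol{\sigma}_e(t)\end{pmatrix}\ni\begin{pmatrix}h_p(t)\\ h_e(t)\end{pmatrix}$$ for $h_p=s_0^{-1}q_p$ and $h_e=0$, then it also solves the alternative weak formulation of the Stokes–Biot problem; that is, there are $\mathbf{u}_f(t)\in\mathbf{V}_f$, $p_f(t)\in W_f$, $\mathbf{u}_p(t)\in\mathbf{V}_p$, $\mathbf{u}_s(t)\in\mathbf{X}_p$, $\lambda(t)\in\Lambda$ such that for all $\mathbf{v}_f\in\mathbf{V}_f$, $w_f\in W_f$, $\mathbf{v}_p\in\mathbf{V}_p$, $w_p\in W_p$, $\mathbf{v}_s\in\mathbf{X}_p$, $\boldsymbol{\tau}_e\in\boldsymbol{\Sigma}_e$, $\mu\in\Lambda$, $$\begin{aligned} &a_f(\mathbf{u}_f,\mathbf{v}_f)+a_p^d(\mathbf{u}_p,\mathbf{v}_p)+a_{BJS}(\mathbf{u}_f,\mathbf{u}_s;\mathbf{v}_f,\mathbf{v}_s)+b_f(\mathbf{v}_f,p_f)+b_p(\mathbf{v}_p,p_p)\\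 &\qquad+\alpha_pb_p(\mathbf{v}_s,p_p)+b_s(\mathbf{v}_s,\boldsymbol{\sigma}_e)+b_\Gamma(\mathbf{v}_f,\mathbf{v}_p,\mathbf{v}_s;\lambda)=(\mathbf{f}_f,\mathbf{v}_f)_{\Omega_f}+(\mathbf{f}_p,\mathbf{v}_s)_{\Omega_p},\\ &(s_0\partial_tp_p,w_p)_{\Omega_p}+a_p^s(\partial_t\boldsymbol{\sigma}_e,\boldsymbol{\tau}_e)-\alpha_pb_p(\mathbf{u}_s,w_p)-b_p(\mathbf{u}_p,w_p)-b_s(\mathbf{u}_s,\boldsymbol{\tau}_e)-b_f(\mathbf{u}_f,w_f)\\ &\qquad=(q_f,w_f)_{\Omega_f}+(q_p,w_p)_{\Omega_p},\\ &b_\Gamma(\mathbf{u}_f,\mathbf{u}_p,\mathbf{u}_s;\mu)=0. \end{aligned}$$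
   Context: Geometry: $d\in\{2,3\}$; $\Omega\subset\mathbb{R}^d$ is a Lipschitz domain subdivided into non-overlapping regions $\Omega_f$ and $\Omega_p$, each a single subdomain; $\Gamma_{fp}=\partial\Omega_f\cap\partial\Omega_p\neq\emptyset$; $\Gamma_f=\partial\Omega_f\setminus\Gamma_{fp}$, $\Gamma_p=\partial\Omega_p\setminus\Gamma_{fp}=\Gamma_p^N\cup\Gamma_p^D$ with $|\Gamma_p^D|>0$ and $\mathrm{dist}(\Gamma_p^D,\Gamma_{fp})\ge s>0$; $\mathbf{n}_f,\mathbf{n}_p$ are the outward unit normals; $\mathbf{t}_{f,j}$, $1\le j\le d-1$, is an orthogonal system of unit tangent vectors on $\Gamma_{fp}$. $T>0$. $\mathbf{D}(\mathbf{v})=\frac12(\nabla\mathbf{v}+\nabla\mathbf{v}^T)$. Parameters: constants $s_0>0$, $\alpha_p$, $\alpha_{BJS}\ge0$, Lamé coefficients $\lambda_p,\mu_p$, and $\kappa$ a scalar uniformly positive and bounded permeability function. $A$ is the symmetric positive definite compliance tensor $A\boldsymbol{\sigma}=\frac1{2\mu_p}\big(\boldsymbol{\sigma}-\frac{\lambda_p}{2\mu_p+d\lambda_p}\mathrm{tr}(\boldsymbol{\sigma})\mathbf{I}\big)$. Viscosities: $1<r<2$, $1/r+1/r'=1$. $\nu=\nu(\mathbf{D}(\mathbf{u}_f))$, $\nu_{eff}=\nu_{eff}(\mathbf{u}_p)$ and $\nu_I$ (function of the magnitude of the tangential part on $\Gamma_{fp}$ of $\mathbf{u}_f-\mathbf{u}_s$)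 are non-negative functions $g$ such that $\mathbf{G}(\mathbf{x})=g(\mathbf{x})\mathbf{x}$ satisfies, for constants $C_3,C_4>0$, $c\ge0$ and all $\mathbf{x},\mathbf{h}$, $$(\mathbf{G}(\mathbf{x}+\mathbf{h})-\mathbf{G}(\mathbf{x}))\cdot\mathbf{h}\ge C_3\frac{|\mathbf{h}|^2}{c+|\mathbf{x}|^{2-r}+|\mathbf{x}+\mathbf{h}|^{2-r}},\qquad |\mathbf{G}(\mathbf{x}+\mathbf{h})-\mathbf{G}(\mathbf{x})|\le C_4\frac{|\mathbf{h}|}{c+|\mathbf{x}|^{2-r}+|\mathbf{x}+\mathbf{h}|^{2-r}},$$ with $\mathbf{G}(\mathbf{0})=\mathbf{0}$ and quotients read as $0$ when $c=0$, $\mathbf{x}=\mathbf{h}=\mathbf{0}$. Spaces: $\mathbf{V}_f=\{\mathbf{v}\in W^{1,r}(\Omega_f)^d:\mathbf{v}=\mathbf{0}\text{ on }\Gamma_f\}$, $W_f=L^{r'}(\Omega_f)$, $\mathbf{V}_p=\{\mathbf{v}\in L^r(\Omega_p)^d:\nabla\cdot\mathbf{v}\in L^r(\Omega_p),\ \mathbf{v}\cdot\mathbf{n}_p=0\text{ on }\Gamma_p^N\}$, $W_p=L^{r'}(\Omega_p)$, $\mathbf{X}_p=\{\boldsymbol{\xi}\in H^1(\Omega_p)^d:\boldsymbol{\xi}=\mathbf{0}\text{ on }\Gamma_p\}$, $\boldsymbol{\Sigma}_e$ = symmetric $d\times d$ tensors with $L^2(\Omega_p)$ entries, $\Lambda=W^{1/r,r'}(\Gamma_{fp})$.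 $W_{p,2}$ and $\boldsymbol{\Sigma}_{e,2}$ are the closures of $W_p$ and $\boldsymbol{\Sigma}_e$ in the norms $(s_0w,w)_{L^2(\Omega_p)}^{1/2}$ and $(A\boldsymbol{\tau},\boldsymbol{\tau})_{L^2(\Omega_p)}^{1/2}$ (so $W_{p,2}=L^2(\Omega_p)$, $\boldsymbol{\Sigma}_{e,2}=\boldsymbol{\Sigma}_e$); their duals are identified with themselves via these inner products. Forms: $a_f(\mathbf{u}_f,\mathbf{v}_f)=(2\nu(\mathbf{D}(\mathbf{u}_f))\mathbf{D}(\mathbf{u}_f),\mathbf{D}(\mathbf{v}_f))_{\Omega_f}$; $a_p^d(\mathbf{u}_p,\mathbf{v}_p)=(\nu_{eff}(\mathbf{u}_p)\kappa^{-1}\mathbf{u}_p,\mathbf{v}_p)_{\Omega_p}$; $a_p^s(\boldsymbol{\sigma}_e,\boldsymbol{\tau}_e)=(A\boldsymbol{\sigma}_e,\boldsymbol{\tau}_e)_{\Omega_p}$; $b_s(\mathbf{v}_s,\boldsymbol{\tau}_e)=(\mathbf{D}(\mathbf{v}_s),\boldsymbol{\tau}_e)_{\Omega_p}$; $b_\star(\mathbf{v},w)=-(\nabla\cdot\mathbf{v},w)_{\Omega_\star}$, $\star=f,p$; $a_{BJS}(\mathbf{u}_f,\mathbf{u}_s;\mathbf{v}_f,\mathbf{v}_s)=\sum_{j=1}^{d-1}\langle\nu_I\alpha_{BJS}\sqrt{\kappa^{-1}}(\mathbf{u}_f-\mathbf{u}_s)\cdot\mathbf{t}_{f,j},(\mathbf{v}_f-\mathbf{v}_s)\cdot\mathbf{t}_{f,j}\rangle_{\Gamma_{fp}}$;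 $b_\Gamma(\mathbf{v}_f,\mathbf{v}_p,\mathbf{v}_s;\mu)=\langle\mathbf{v}_f\cdot\mathbf{n}_f+(\mathbf{v}_s+\mathbf{v}_p)\cdot\mathbf{n}_p,\mu\rangle_{\Gamma_{fp}}$. Resolvent-type system: for given $(\mathbf{f}_f,\mathbf{f}_p,q_f)\in\mathbf{V}_f'\times\mathbf{X}_p'\times W_f'$ (here the values of the data at time $t$), a pair $(p_p,\boldsymbol{\sigma}_e)\in W_p\times\boldsymbol{\Sigma}_e$ is said to satisfy system (R) for $(\bar g_p,\bar g_e)\in W_{p,2}'\times\boldsymbol{\Sigma}_{e,2}'$ if there exist $(\mathbf{u}_p,\mathbf{u}_s,\mathbf{u}_f)\in\mathbf{V}_p\times\mathbf{X}_p\times\mathbf{V}_f$, $p_f\in W_f$, $\lambda\in\Lambda$ such that for all $\mathbf{v}_p\in\mathbf{V}_p,\mathbf{v}_s\in\mathbf{X}_p,\mathbf{v}_f\in\mathbf{V}_f,w_p\in W_p,\boldsymbol{\tau}_e\in\boldsymbol{\Sigma}_e,w_f\in W_f,\mu\in\Lambda$: (1) $a_f(\mathbf{u}_f,\mathbf{v}_f)+a_p^d(\mathbf{u}_p,\mathbf{v}_p)+a_{BJS}(\mathbf{u}_f,\mathbf{u}_s;\mathbf{v}_f,\mathbf{v}_s)+b_f(\mathbf{v}_f,p_f)+b_p(\mathbf{v}_p,p_p)+\alpha_pb_p(\mathbf{v}_s,p_p)+b_s(\mathbf{v}_s,\boldsymbol{\sigma}_e)+b_\Gamma(\mathbf{v}_f,\mathbf{v}_p,\mathbf{v}_s;\lambda)=(\mathbf{f}_f,\mathbf{v}_f)_{\Omega_f}+(\mathbf{f}_p,\mathbf{v}_s)_{\Omega_p}$;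 (2) $(s_0p_p,w_p)_{\Omega_p}+a_p^s(\boldsymbol{\sigma}_e,\boldsymbol{\tau}_e)-\alpha_pb_p(\mathbf{u}_s,w_p)-b_p(\mathbf{u}_p,w_p)-b_s(\mathbf{u}_s,\boldsymbol{\tau}_e)-b_f(\mathbf{u}_f,w_f)=(q_f,w_f)_{\Omega_f}+(s_0\bar g_p,w_p)_{\Omega_p}+(A\bar g_e,\boldsymbol{\tau}_e)_{\Omega_p}$; (3) $b_\Gamma(\mathbf{u}_f,\mathbf{u}_p,\mathbf{u}_s;\mu)=0$. $D$ is the set of $(p_p,\boldsymbol{\sigma}_e)\in W_p\times\boldsymbol{\Sigma}_e$ satisfying (R) for some $(\bar g_p,\bar g_e)\in W_{p,2}'\times\boldsymbol{\Sigma}_{e,2}'$, and the multivalued operator $\mathcal{M}$ with domain $D$ is $\mathcal{M}((p_p,\boldsymbol{\sigma}_e))=\{(\bar g_p-p_p,\bar g_e-\boldsymbol{\sigma}_e):(p_p,\boldsymbol{\sigma}_e)\text{ satisfies (R) for }(\bar g_p,\bar g_e)\in W_{p,2}'\times\boldsymbol{\Sigma}_{e,2}'\}$. *)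

theory Defs
  imports "HOL-Analysis.Analysis"
begin

(* Function spaces are rendered as sets of representatives, not of equivalence classes.  The
   values of a representative outside the domain (or boundary piece) concerned never matter. *)

section \<open>Lebesgue spaces, surface measure, Lipschitz domains\<close>

definition Lp :: "'a measure \<Rightarrow> real \<Rightarrow> ('a \<Rightarrow> 'b::euclidean_space) set" where
  "Lp M p = {f \<in> borel_measurable M. integrable M (\<lambda>x. norm (f x) powr p)}"

definition Lp_norm :: "'a measure \<Rightarrow> real \<Rightarrow> ('a \<Rightarrow> 'b::euclidean_space) \<Rightarrow> real" where
  "Lp_norm M p f = (\<integral>x. norm (f x) powr p \<partial>M) powr (1 / p)"

definition converges_Lp ::
  "'a measure \<Rightarrow> real \<Rightarrow> (nat \<Rightarrow> 'a \<Rightarrow> 'b::euclidean_space) \<Rightarrow> ('a \<Rightarrow> 'b) \<Rightarrow> bool" where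
  "converges_Lp M p F f \<longleftrightarrow>
     (\<forall>n. (\<lambda>x. F n x - f x) \<in> Lp M p) \<and> (\<lambda>n. Lp_norm M p (\<lambda>x. F n x - f x)) \<longlonglongrightarrow> 0"

definition hausdorff_pre :: "nat \<Rightarrow> real \<Rightarrow> 'a::euclidean_space set \<Rightarrow> ennreal" where
  "hausdorff_pre k \<delta> A =
     (INF U \<in> {U :: nat \<Rightarrow> 'a set. (\<forall>i. bounded (U i) \<and> diameter (U i) \<le> \<delta>) \<and> A \<subseteq> (\<Union>i. U i)}.
        \<Sum>i. ennreal (unit_ball_vol (real k) * (diameter (U i) / 2) ^ k))"

definition hausdorff_outer :: "nat \<Rightarrow> 'a::euclidean_space set \<Rightarrow> ennreal" where
  "hausdorff_outer k A = (SUP \<delta> \<in> {0<..}. hausdorff_pre k \<delta> A)"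

(* The outer measure is a metric outer measure, hence countably additive on Borel sets, so that
   emeasure agrees with it there.  Only k >= 1 is used. *)
definition hausdorff_measure :: "nat \<Rightarrow> 'a::euclidean_space measure" where
  "hausdorff_measure k = measure_of UNIV (sets borel) (hausdorff_outer k)"

definition surf :: "'a::euclidean_space set \<Rightarrow> 'a measure" where
  "surf \<Gamma> = restrict_space (hausdorff_measure (DIM('a) - 1)) \<Gamma>"

(* Near each boundary point the domain is, in rotated coordinates with last axis e, the
   hypograph of a Lipschitz function of the coordinates orthogonal to e. *)
definition lipschitz_domain :: "'a::euclidean_space set \<Rightarrow> bool" where
  "lipschitz_domain \<Omega> \<longleftrightarrow> \<Omega> \<noteq> {} \<and> open \<Omega> \<and> connected \<Omega> \<and> bounded \<Omega> \<and>
     (\<forall>x \<in> frontier \<Omega>. \<exists>U e L \<gamma>. open U \<and> x \<in> U \<and> norm e = 1 \<and>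
        L-lipschitz_on {z. z \<bullet> e = 0} (\<gamma> :: 'a \<Rightarrow> real) \<and>
        (\<forall>y \<in> U. y \<in> \<Omega> \<longleftrightarrow> y \<bullet> e < \<gamma> (y - (y \<bullet> e) *\<^sub>R e)))"

(* Classical (Frechet) normal; on a Lipschitz boundary it exists at almost every point by
   Rademacher's theorem, and it is unique where it exists. *)
definition is_outward_normal :: "'a::euclidean_space set \<Rightarrow> 'a \<Rightarrow> 'a \<Rightarrow> bool" where
  "is_outward_normal \<Omega> x n \<longleftrightarrow> norm n = 1 \<and>
     (\<forall>\<epsilon>>0. \<exists>\<delta>>0. \<forall>y. 0 < norm (y - x) \<and> norm (y - x) < \<delta> \<longrightarrow>
        ((y - x) \<bullet> n \<ge> \<epsilon> * norm (y - x) \<longrightarrow> y \<notin> closure \<Omega>) \<and>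
        ((y - x) \<bullet> n \<le> - \<epsilon> * norm (y - x) \<longrightarrow> y \<in> \<Omega>))"

definition normal :: "'a::euclidean_space set \<Rightarrow> 'a \<Rightarrow> 'a" where
  "normal \<Omega> x = (THE n. is_outward_normal \<Omega> x n)"


section \<open>Weak derivatives, Sobolev spaces, traces\<close>

abbreviation partial :: "('a::euclidean_space \<Rightarrow> real) \<Rightarrow> 'a \<Rightarrow> 'a \<Rightarrow> real" where
  "partial f b x \<equiv> frechet_derivative f (at x) b"

primrec Ck :: "nat \<Rightarrow> ('a::euclidean_space \<Rightarrow> real) \<Rightarrow> bool" where
  "Ck 0 f \<longleftrightarrow> continuous_on UNIV f"
| "Ck (Suc k) f \<longleftrightarrow> (\<forall>x. f differentiable (at x)) \<and> (\<forall>b \<in> Basis. Ck k (\<lambda>x. partial f b x))"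

definition smooth :: "('a::euclidean_space \<Rightarrow> real) \<Rightarrow> bool" where
  "smooth f \<longleftrightarrow> (\<forall>k. Ck k f)"

definition test_functions :: "'a::euclidean_space set \<Rightarrow> ('a \<Rightarrow> real) set" where
  "test_functions \<Omega> =
     {\<phi>. smooth \<phi> \<and> compact (closure {x. \<phi> x \<noteq> 0}) \<and> closure {x. \<phi> x \<noteq> 0} \<subseteq> \<Omega>}"

definition locally_integrable ::
  "'a::euclidean_space set \<Rightarrow> ('a \<Rightarrow> 'b::euclidean_space) \<Rightarrow> bool" where
  "locally_integrable \<Omega> f \<longleftrightarrow> (\<forall>K. compact K \<and> K \<subseteq> \<Omega> \<longrightarrow> integrable (lebesgue_on K) f)"

definition is_weak_partial ::
  "'a::euclidean_space set \<Rightarrow> 'a \<Rightarrow> ('a \<Rightarrow> real) \<Rightarrow> ('a \<Rightarrow> real) \<Rightarrow> bool" where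
  "is_weak_partial \<Omega> b u g \<longleftrightarrow> locally_integrable \<Omega> u \<and> locally_integrable \<Omega> g \<and>
     (\<forall>\<phi> \<in> test_functions \<Omega>.
        (\<integral>x. u x * partial \<phi> b x \<partial>lebesgue_on \<Omega>) = - (\<integral>x. g x * \<phi> x \<partial>lebesgue_on \<Omega>))"

(* Weak derivatives are unique almost everywhere; SOME picks a representative. *)
definition weak_partial :: "'a::euclidean_space set \<Rightarrow> 'a \<Rightarrow> ('a \<Rightarrow> real) \<Rightarrow> 'a \<Rightarrow> real" where
  "weak_partial \<Omega> b u = (SOME g. is_weak_partial \<Omega> b u g)"

definition weak_grad :: "'a::euclidean_space set \<Rightarrow> ('a \<Rightarrow> real) \<Rightarrow> 'a \<Rightarrow> 'a" where
  "weak_grad \<Omega> u x = (\<Sum>b\<in>Basis. weak_partial \<Omega> b u x *\<^sub>R b)"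

definition is_weak_div ::
  "'a::euclidean_space set \<Rightarrow> ('a \<Rightarrow> 'a) \<Rightarrow> ('a \<Rightarrow> real) \<Rightarrow> bool" where
  "is_weak_div \<Omega> v g \<longleftrightarrow> locally_integrable \<Omega> v \<and> locally_integrable \<Omega> g \<and>
     (\<forall>\<phi> \<in> test_functions \<Omega>.
        (\<integral>x. (\<Sum>b\<in>Basis. (v x \<bullet> b) * partial \<phi> b x) \<partial>lebesgue_on \<Omega>) =
        - (\<integral>x. g x * \<phi> x \<partial>lebesgue_on \<Omega>))"

definition weak_div :: "'a::euclidean_space set \<Rightarrow> ('a \<Rightarrow> 'a) \<Rightarrow> 'a \<Rightarrow> real" where
  "weak_div \<Omega> v = (SOME g. is_weak_div \<Omega> v g)"

definition W1p :: "'a::euclidean_space set \<Rightarrow> real \<Rightarrow> ('a \<Rightarrow> real) set" where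
  "W1p \<Omega> p = {u \<in> Lp (lebesgue_on \<Omega>) p.
     \<forall>b\<in>Basis. \<exists>g \<in> Lp (lebesgue_on \<Omega>) p. is_weak_partial \<Omega> b u g}"

(* g is the trace of u: u is the W^{1,p} limit of smooth functions (restrictions to the domain
   of smooth functions on the whole space) whose boundary values converge to g in L^p of the
   boundary.  On a Lipschitz domain this is the graph of the usual trace operator. *)
definition is_trace ::
  "'a::euclidean_space set \<Rightarrow> real \<Rightarrow> ('a \<Rightarrow> real) \<Rightarrow> ('a \<Rightarrow> real) \<Rightarrow> bool" where
  "is_trace \<Omega> p u g \<longleftrightarrow> u \<in> W1p \<Omega> p \<and> g \<in> Lp (surf (frontier \<Omega>)) p \<and>
     (\<exists>\<phi>. (\<forall>n. smooth (\<phi> n)) \<and> converges_Lp (lebesgue_on \<Omega>) p \<phi> u \<and>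
        (\<forall>b\<in>Basis. converges_Lp (lebesgue_on \<Omega>) p (\<lambda>n. partial (\<phi> n) b) (weak_partial \<Omega> b u)) \<and>
        converges_Lp (surf (frontier \<Omega>)) p \<phi> g)"

definition tr :: "'a::euclidean_space set \<Rightarrow> real \<Rightarrow> ('a \<Rightarrow> real) \<Rightarrow> 'a \<Rightarrow> real" where
  "tr \<Omega> p u = (SOME g. is_trace \<Omega> p u g)"

definition W1p_vec :: "(real^'n) set \<Rightarrow> real \<Rightarrow> (real^'n \<Rightarrow> real^'n) set" where
  "W1p_vec \<Omega> p = {v. \<forall>i. (\<lambda>x. v x $ i) \<in> W1p \<Omega> p}"

definition tr_vec :: "(real^'n) set \<Rightarrow> real \<Rightarrow> (real^'n \<Rightarrow> real^'n) \<Rightarrow> real^'n \<Rightarrow> real^'n" where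
  "tr_vec \<Omega> p v x = (\<chi> i. tr \<Omega> p (\<lambda>y. v y $ i) x)"

definition weak_jacobian :: "(real^'n) set \<Rightarrow> (real^'n \<Rightarrow> real^'n) \<Rightarrow> real^'n \<Rightarrow> real^'n^'n" where
  "weak_jacobian \<Omega> v x = (\<chi> i j. weak_partial \<Omega> (axis j 1) (\<lambda>y. v y $ i) x)"

definition symgrad :: "(real^'n) set \<Rightarrow> (real^'n \<Rightarrow> real^'n) \<Rightarrow> real^'n \<Rightarrow> real^'n^'n" where
  "symgrad \<Omega> v x = (1/2) *\<^sub>R (weak_jacobian \<Omega> v x + transpose (weak_jacobian \<Omega> v x))"

definition W1p_vec_norm :: "(real^'n) set \<Rightarrow> real \<Rightarrow> (real^'n \<Rightarrow> real^'n) \<Rightarrow> real" where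
  "W1p_vec_norm \<Omega> p v =
     (Lp_norm (lebesgue_on \<Omega>) p v powr p + Lp_norm (lebesgue_on \<Omega>) p (weak_jacobian \<Omega> v) powr p)
       powr (1 / p)"

(* Sobolev-Slobodeckij space of fractional order 0 < s < 1 on a hypersurface. *)
definition Wsp_surf :: "'a::euclidean_space set \<Rightarrow> real \<Rightarrow> real \<Rightarrow> ('a \<Rightarrow> real) set" where
  "Wsp_surf \<Gamma> s p = {\<mu> \<in> Lp (surf \<Gamma>) p.
     (\<integral>\<^sup>+x. \<integral>\<^sup>+y. ennreal (\<bar>\<mu> x - \<mu> y\<bar> powr p / dist x y powr (real (DIM('a) - 1) + s * p))
        \<partial>surf \<Gamma> \<partial>surf \<Gamma>) < \<infinity>}"

(* Green's formula: the duality pairing of v . n with the trace of w on the boundary. *)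
definition green_pairing ::
  "'a::euclidean_space set \<Rightarrow> ('a \<Rightarrow> 'a) \<Rightarrow> ('a \<Rightarrow> real) \<Rightarrow> real" where
  "green_pairing \<Omega> v w = (\<integral>x. v x \<bullet> weak_grad \<Omega> w x + weak_div \<Omega> v x * w x \<partial>lebesgue_on \<Omega>)"


section \<open>Dual spaces and Bochner--Sobolev spaces of functions of time\<close>

(* X is a linear space of functions with (semi)norm N; elements of the dual are compared through
   their values on X only. *)
definition dual_space :: "('a \<Rightarrow> 'b::real_vector) set \<Rightarrow> (('a \<Rightarrow> 'b) \<Rightarrow> real) \<Rightarrow> (('a \<Rightarrow> 'b) \<Rightarrow> real) set" where
  "dual_space X N = {F. (\<forall>u\<in>X. \<forall>v\<in>X. F (\<lambda>x. u x + v x) = F u + F v) \<and>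
     (\<forall>c. \<forall>u\<in>X. F (\<lambda>x. c *\<^sub>R u x) = c * F u) \<and> (\<exists>C. \<forall>u\<in>X. \<bar>F u\<bar> \<le> C * N u)}"

definition dual_norm :: "('a \<Rightarrow> 'b::real_vector) set \<Rightarrow> (('a \<Rightarrow> 'b) \<Rightarrow> real) \<Rightarrow> (('a \<Rightarrow> 'b) \<Rightarrow> real) \<Rightarrow> real" where
  "dual_norm X N F = (SUP u \<in> {u\<in>X. N u \<le> 1}. \<bar>F u\<bar>)"

definition bochner_L1_dual ::
  "real \<Rightarrow> ('a \<Rightarrow> 'b::real_vector) set \<Rightarrow> (('a \<Rightarrow> 'b) \<Rightarrow> real) \<Rightarrow> (real \<Rightarrow> ('a \<Rightarrow> 'b) \<Rightarrow> real) \<Rightarrow> bool" where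
  "bochner_L1_dual T X N F \<longleftrightarrow>
     (AE t in lebesgue_on {0<..<T}. F t \<in> dual_space X N) \<and>
     (\<exists>S. (\<forall>n. simple_function (lebesgue_on {0<..<T}) (S n) \<and> (\<forall>t. S n t \<in> dual_space X N)) \<and>
        (AE t in lebesgue_on {0<..<T}. (\<lambda>n. dual_norm X N (\<lambda>u. S n t u - F t u)) \<longlonglongrightarrow> 0)) \<and>
     integrable (lebesgue_on {0<..<T}) (\<lambda>t. dual_norm X N (F t))"

(* F belongs to W^{1,1}(0,T;X') and G is its weak time derivative. *)
definition has_time_derivative_dual ::
  "real \<Rightarrow> ('a \<Rightarrow> 'b::real_vector) set \<Rightarrow> (('a \<Rightarrow> 'b) \<Rightarrow> real) \<Rightarrow>
   (real \<Rightarrow> ('a \<Rightarrow> 'b) \<Rightarrow> real) \<Rightarrow> (real \<Rightarrow> ('a \<Rightarrow> 'b) \<Rightarrow> real) \<Rightarrow> bool" where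
  "has_time_derivative_dual T X N F G \<longleftrightarrow> bochner_L1_dual T X N F \<and> bochner_L1_dual T X N G \<and>
     (\<forall>u\<in>X. \<forall>\<phi> \<in> test_functions {0<..<T}.
        (\<integral>t. F t u * deriv \<phi> t \<partial>lebesgue_on {0<..<T}) =
        - (\<integral>t. G t u * \<phi> t \<partial>lebesgue_on {0<..<T}))"

definition W11_dual ::
  "real \<Rightarrow> ('a \<Rightarrow> 'b::real_vector) set \<Rightarrow> (('a \<Rightarrow> 'b) \<Rightarrow> real) \<Rightarrow> (real \<Rightarrow> ('a \<Rightarrow> 'b) \<Rightarrow> real) \<Rightarrow> bool" where
  "W11_dual T X N F \<longleftrightarrow> (\<exists>G. has_time_derivative_dual T X N F G)"


section \<open>The Stokes--Biot problem\<close>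

record ('n::finite) stokes_biot =
  Om_f :: "(real^'n) set"
  Om_p :: "(real^'n) set"
  Gam_pN :: "(real^'n) set"
  Gam_pD :: "(real^'n) set"
  tang :: "nat \<Rightarrow> real^'n \<Rightarrow> real^'n"
  r_exp :: real
  r_conj :: real
  s0 :: real
  alpha_p :: real
  alpha_BJS :: real
  lam_p :: real
  mu_p :: real
  kappa :: "real^'n \<Rightarrow> real"
  nu :: "real^'n^'n \<Rightarrow> real"
  nu_eff :: "real^'n \<Rightarrow> real"
  nu_I :: "real \<Rightarrow> real"

definition Gam_fp :: "('n::finite) stokes_biot \<Rightarrow> (real^'n) set" where
  "Gam_fp P = frontier (Om_f P) \<inter> frontier (Om_p P)"

definition Gam_f :: "('n::finite) stokes_biot \<Rightarrow> (real^'n) set" where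
  "Gam_f P = frontier (Om_f P) - Gam_fp P"

definition Gam_p :: "('n::finite) stokes_biot \<Rightarrow> (real^'n) set" where
  "Gam_p P = frontier (Om_p P) - Gam_fp P"

definition compliance :: "('n::finite) stokes_biot \<Rightarrow> real^'n^'n \<Rightarrow> real^'n^'n" where
  "compliance P \<sigma> = (1 / (2 * mu_p P)) *\<^sub>R
     (\<sigma> - (lam_p P / (2 * mu_p P + real CARD('n) * lam_p P) * trace \<sigma>) *\<^sub>R mat 1)"

(* Quotients whose denominator vanishes (c = 0, x = h = 0) are 0 by the convention for division. *)
definition viscosity_law :: "real \<Rightarrow> 'a::euclidean_space set \<Rightarrow> ('a \<Rightarrow> real) \<Rightarrow> bool" where
  "viscosity_law r S g \<longleftrightarrow> (\<forall>x\<in>S. 0 \<le> g x) \<and>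
     (\<exists>C3>0. \<exists>C4>0. \<exists>c\<ge>0. \<forall>x\<in>S. \<forall>h\<in>S.
        (g (x + h) *\<^sub>R (x + h) - g x *\<^sub>R x) \<bullet> h
          \<ge> C3 * ((norm h)\<^sup>2 / (c + norm x powr (2 - r) + norm (x + h) powr (2 - r))) \<and>
        norm (g (x + h) *\<^sub>R (x + h) - g x *\<^sub>R x)
          \<le> C4 * (norm h / (c + norm x powr (2 - r) + norm (x + h) powr (2 - r))))"

definition geometry :: "(real^'n) set \<Rightarrow> ('n::finite) stokes_biot \<Rightarrow> bool" where
  "geometry \<Omega> P \<longleftrightarrow>
     (CARD('n) = 2 \<or> CARD('n) = 3) \<and> lipschitz_domain \<Omega> \<and>
     open (Om_f P) \<and> connected (Om_f P) \<and> Om_f P \<noteq> {} \<and>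
     open (Om_p P) \<and> connected (Om_p P) \<and> Om_p P \<noteq> {} \<and>
     Om_f P \<inter> Om_p P = {} \<and> Om_f P \<union> Om_p P \<subseteq> \<Omega> \<and> \<Omega> \<subseteq> closure (Om_f P) \<union> closure (Om_p P) \<and>
     Gam_fp P \<noteq> {} \<and> Gam_p P = Gam_pN P \<union> Gam_pD P \<and>
     emeasure (surf (frontier (Om_p P))) (Gam_pD P) > 0 \<and>
     (\<exists>s>0. \<forall>x \<in> Gam_pD P. \<forall>y \<in> Gam_fp P. dist x y \<ge> s) \<and>
     (\<forall>j \<in> {1..CARD('n) - 1}. tang P j \<in> borel_measurable (surf (Gam_fp P))) \<and>
     (AE x in surf (Gam_fp P). \<forall>j \<in> {1..CARD('n) - 1}.
        norm (tang P j x) = 1 \<and> tang P j x \<bullet> normal (Om_f P) x = 0 \<and>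
        (\<forall>k \<in> {1..CARD('n) - 1}. k \<noteq> j \<longrightarrow> tang P j x \<bullet> tang P k x = 0))"

(* nu is a function of symmetric tensors; nu_I enters through the map G(x) = nu_I(|x|) x on the
   (d-1)-dimensional space of tangent vectors, i.e. on an arbitrary hyperplane through 0.
   kappa also enters the interface condition, so it is given on the interface as well. *)
definition parameters :: "('n::finite) stokes_biot \<Rightarrow> bool" where
  "parameters P \<longleftrightarrow>
     1 < r_exp P \<and> r_exp P < 2 \<and> 1 / r_exp P + 1 / r_conj P = 1 \<and>
     s0 P > 0 \<and> alpha_BJS P \<ge> 0 \<and>
     (\<forall>\<tau>. transpose \<tau> = \<tau> \<and> \<tau> \<noteq> 0 \<longrightarrow> compliance P \<tau> \<bullet> \<tau> > 0) \<and>
     kappa P \<in> borel_measurable (lebesgue_on (Om_p P)) \<and>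
     kappa P \<in> borel_measurable (surf (Gam_fp P)) \<and>
     (\<exists>k K. 0 < k \<and> (\<forall>x \<in> Om_p P \<union> Gam_fp P. k \<le> kappa P x \<and> kappa P x \<le> K)) \<and>
     viscosity_law (r_exp P) {\<tau>. transpose \<tau> = \<tau>} (nu P) \<and>
     viscosity_law (r_exp P) UNIV (nu_eff P) \<and>
     (\<forall>e :: real^'n. norm e = 1 \<longrightarrow>
        viscosity_law (r_exp P) {x. x \<bullet> e = 0} (\<lambda>x. nu_I P (norm x)))"

definition Vf :: "('n::finite) stokes_biot \<Rightarrow> (real^'n \<Rightarrow> real^'n) set" where
  "Vf P = {v \<in> W1p_vec (Om_f P) (r_exp P).
     AE x in surf (frontier (Om_f P)). x \<in> Gam_f P \<longrightarrow> tr_vec (Om_f P) (r_exp P) v x = 0}"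

definition Vf_norm :: "('n::finite) stokes_biot \<Rightarrow> (real^'n \<Rightarrow> real^'n) \<Rightarrow> real" where
  "Vf_norm P = W1p_vec_norm (Om_f P) (r_exp P)"

definition Wf :: "('n::finite) stokes_biot \<Rightarrow> (real^'n \<Rightarrow> real) set" where
  "Wf P = Lp (lebesgue_on (Om_f P)) (r_conj P)"

definition Wf_norm :: "('n::finite) stokes_biot \<Rightarrow> (real^'n \<Rightarrow> real) \<Rightarrow> real" where
  "Wf_norm P = Lp_norm (lebesgue_on (Om_f P)) (r_conj P)"

(* The normal component of v is only a functional on W^{1/r,r'} of the boundary; it vanishes on
   Gam_pN if it annihilates all traces that vanish on the rest of the boundary. *)
definition Vp :: "('n::finite) stokes_biot \<Rightarrow> (real^'n \<Rightarrow> real^'n) set" where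
  "Vp P = {v \<in> Lp (lebesgue_on (Om_p P)) (r_exp P).
     (\<exists>g \<in> Lp (lebesgue_on (Om_p P)) (r_exp P). is_weak_div (Om_p P) v g) \<and>
     (\<forall>w \<in> W1p (Om_p P) (r_conj P).
        (AE x in surf (frontier (Om_p P)). x \<notin> Gam_pN P \<longrightarrow> tr (Om_p P) (r_conj P) w x = 0) \<longrightarrow>
        green_pairing (Om_p P) v w = 0)}"

definition Wp :: "('n::finite) stokes_biot \<Rightarrow> (real^'n \<Rightarrow> real) set" where
  "Wp P = Lp (lebesgue_on (Om_p P)) (r_conj P)"

definition Wp_norm :: "('n::finite) stokes_biot \<Rightarrow> (real^'n \<Rightarrow> real) \<Rightarrow> real" where
  "Wp_norm P = Lp_norm (lebesgue_on (Om_p P)) (r_conj P)"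

definition Xp :: "('n::finite) stokes_biot \<Rightarrow> (real^'n \<Rightarrow> real^'n) set" where
  "Xp P = {\<xi> \<in> W1p_vec (Om_p P) 2.
     AE x in surf (frontier (Om_p P)). x \<in> Gam_p P \<longrightarrow> tr_vec (Om_p P) 2 \<xi> x = 0}"

definition Xp_norm :: "('n::finite) stokes_biot \<Rightarrow> (real^'n \<Rightarrow> real^'n) \<Rightarrow> real" where
  "Xp_norm P = W1p_vec_norm (Om_p P) 2"

definition Sigma_e :: "('n::finite) stokes_biot \<Rightarrow> (real^'n \<Rightarrow> real^'n^'n) set" where
  "Sigma_e P = {\<tau> \<in> Lp (lebesgue_on (Om_p P)) 2.
     AE x in lebesgue_on (Om_p P). transpose (\<tau> x) = \<tau> x}"

definition Lam :: "('n::finite) stokes_biot \<Rightarrow> (real^'n \<Rightarrow> real) set" where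
  "Lam P = Wsp_surf (Gam_fp P) (1 / r_exp P) (r_conj P)"

(* The closures of Wp and Sigma_e in the norms (s0 w, w)^{1/2} and (A tau, tau)^{1/2} are L^2 and
   Sigma_e itself; both are identified with their duals through these inner products. *)
definition Wp2 :: "('n::finite) stokes_biot \<Rightarrow> (real^'n \<Rightarrow> real) set" where
  "Wp2 P = Lp (lebesgue_on (Om_p P)) 2"

abbreviation Sigma_e2 :: "('n::finite) stokes_biot \<Rightarrow> (real^'n \<Rightarrow> real^'n^'n) set" where
  "Sigma_e2 P \<equiv> Sigma_e P"

definition ip :: "(real^'n) set \<Rightarrow> (real^'n \<Rightarrow> 'b::euclidean_space) \<Rightarrow> (real^'n \<Rightarrow> 'b) \<Rightarrow> real" where
  "ip \<Omega> u v = (\<integral>x. u x \<bullet> v x \<partial>lebesgue_on \<Omega>)"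

definition Sigma_e2_norm :: "('n::finite) stokes_biot \<Rightarrow> (real^'n \<Rightarrow> real^'n^'n) \<Rightarrow> real" where
  "Sigma_e2_norm P \<tau> = sqrt (ip (Om_p P) (\<lambda>x. compliance P (\<tau> x)) \<tau>)"

definition a_f :: "('n::finite) stokes_biot \<Rightarrow> (real^'n \<Rightarrow> real^'n) \<Rightarrow> (real^'n \<Rightarrow> real^'n) \<Rightarrow> real" where
  "a_f P u v =
     ip (Om_f P) (\<lambda>x. (2 * nu P (symgrad (Om_f P) u x)) *\<^sub>R symgrad (Om_f P) u x) (symgrad (Om_f P) v)"

definition a_pd :: "('n::finite) stokes_biot \<Rightarrow> (real^'n \<Rightarrow> real^'n) \<Rightarrow> (real^'n \<Rightarrow> real^'n) \<Rightarrow> real" where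
  "a_pd P u v = ip (Om_p P) (\<lambda>x. (nu_eff P (u x) * inverse (kappa P x)) *\<^sub>R u x) v"

definition a_ps :: "('n::finite) stokes_biot \<Rightarrow> (real^'n \<Rightarrow> real^'n^'n) \<Rightarrow> (real^'n \<Rightarrow> real^'n^'n) \<Rightarrow> real" where
  "a_ps P \<sigma> \<tau> = ip (Om_p P) (\<lambda>x. compliance P (\<sigma> x)) \<tau>"

definition b_s :: "('n::finite) stokes_biot \<Rightarrow> (real^'n \<Rightarrow> real^'n) \<Rightarrow> (real^'n \<Rightarrow> real^'n^'n) \<Rightarrow> real" where
  "b_s P v \<tau> = ip (Om_p P) (symgrad (Om_p P) v) \<tau>"

definition b_f :: "('n::finite) stokes_biot \<Rightarrow> (real^'n \<Rightarrow> real^'n) \<Rightarrow> (real^'n \<Rightarrow> real) \<Rightarrow> real" where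
  "b_f P v w = - ip (Om_f P) (weak_div (Om_f P) v) w"

definition b_p :: "('n::finite) stokes_biot \<Rightarrow> (real^'n \<Rightarrow> real^'n) \<Rightarrow> (real^'n \<Rightarrow> real) \<Rightarrow> real" where
  "b_p P v w = - ip (Om_p P) (weak_div (Om_p P) v) w"

definition jump :: "('n::finite) stokes_biot \<Rightarrow> (real^'n \<Rightarrow> real^'n) \<Rightarrow> (real^'n \<Rightarrow> real^'n) \<Rightarrow> real^'n \<Rightarrow> real^'n" where
  "jump P uf us x = tr_vec (Om_f P) (r_exp P) uf x - tr_vec (Om_p P) 2 us x"

definition tang_part :: "('n::finite) stokes_biot \<Rightarrow> (real^'n \<Rightarrow> real^'n) \<Rightarrow> real^'n \<Rightarrow> real^'n" where
  "tang_part P w x = w x - (w x \<bullet> normal (Om_f P) x) *\<^sub>R normal (Om_f P) x"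

definition a_BJS :: "('n::finite) stokes_biot \<Rightarrow> (real^'n \<Rightarrow> real^'n) \<Rightarrow> (real^'n \<Rightarrow> real^'n) \<Rightarrow>
    (real^'n \<Rightarrow> real^'n) \<Rightarrow> (real^'n \<Rightarrow> real^'n) \<Rightarrow> real" where
  "a_BJS P uf us vf vs = (\<Sum>j = 1..CARD('n) - 1.
     \<integral>x. nu_I P (norm (tang_part P (jump P uf us) x)) * alpha_BJS P * sqrt (inverse (kappa P x))
          * (jump P uf us x \<bullet> tang P j x) * (jump P vf vs x \<bullet> tang P j x) \<partial>surf (Gam_fp P))"

(* An extension of mu from Gam_fp to the domain whose trace vanishes on Gam_pD.  The pairing of
   v . n_p with mu, for v in Vp, does not depend on which one is chosen, because v . n_p
   vanishes on Gam_pN. *)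
definition lift :: "('n::finite) stokes_biot \<Rightarrow> (real^'n \<Rightarrow> real) \<Rightarrow> real^'n \<Rightarrow> real" where
  "lift P \<mu> = (SOME w. w \<in> W1p (Om_p P) (r_conj P) \<and>
     (AE x in surf (frontier (Om_p P)).
        (x \<in> Gam_fp P \<longrightarrow> tr (Om_p P) (r_conj P) w x = \<mu> x) \<and>
        (x \<in> Gam_pD P \<longrightarrow> tr (Om_p P) (r_conj P) w x = 0)))"

definition b_Gam :: "('n::finite) stokes_biot \<Rightarrow> (real^'n \<Rightarrow> real^'n) \<Rightarrow> (real^'n \<Rightarrow> real^'n) \<Rightarrow>
    (real^'n \<Rightarrow> real^'n) \<Rightarrow> (real^'n \<Rightarrow> real) \<Rightarrow> real" where
  "b_Gam P vf vp vs \<mu> =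
     (\<integral>x. (tr_vec (Om_f P) (r_exp P) vf x \<bullet> normal (Om_f P) x) * \<mu> x \<partial>surf (Gam_fp P))
     + (\<integral>x. (tr_vec (Om_p P) 2 vs x \<bullet> normal (Om_p P) x) * \<mu> x \<partial>surf (Gam_fp P))
     + green_pairing (Om_p P) vp (lift P \<mu>)"


section \<open>The resolvent system and the multivalued operator\<close>

definition resolvent_system ::
  "('n::finite) stokes_biot \<Rightarrow> ((real^'n \<Rightarrow> real^'n) \<Rightarrow> real) \<Rightarrow> ((real^'n \<Rightarrow> real^'n) \<Rightarrow> real) \<Rightarrow>
   ((real^'n \<Rightarrow> real) \<Rightarrow> real) \<Rightarrow> (real^'n \<Rightarrow> real) \<times> (real^'n \<Rightarrow> real^'n^'n) \<Rightarrow>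
   (real^'n \<Rightarrow> real) \<times> (real^'n \<Rightarrow> real^'n^'n) \<Rightarrow> bool" where
  "resolvent_system P ff fp qf = (\<lambda>(pp, \<sigma>) (gp, ge).
     pp \<in> Wp P \<and> \<sigma> \<in> Sigma_e P \<and> gp \<in> Wp2 P \<and> ge \<in> Sigma_e2 P \<and>
     (\<exists>up \<in> Vp P. \<exists>us \<in> Xp P. \<exists>uf \<in> Vf P. \<exists>pf \<in> Wf P. \<exists>lam \<in> Lam P.
        \<forall>vp \<in> Vp P. \<forall>vs \<in> Xp P. \<forall>vf \<in> Vf P. \<forall>wp \<in> Wp P. \<forall>\<tau> \<in> Sigma_e P. \<forall>wf \<in> Wf P. \<forall>\<mu> \<in> Lam P.
          a_f P uf vf + a_pd P up vp + a_BJS P uf us vf vs + b_f P vf pf + b_p P vp pp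
            + alpha_p P * b_p P vs pp + b_s P vs \<sigma> + b_Gam P vf vp vs lam
            = ff vf + fp vs \<and>
          ip (Om_p P) (\<lambda>x. s0 P * pp x) wp + a_ps P \<sigma> \<tau> - alpha_p P * b_p P us wp - b_p P up wp
            - b_s P us \<tau> - b_f P uf wf
            = qf wf + ip (Om_p P) (\<lambda>x. s0 P * gp x) wp + ip (Om_p P) (\<lambda>x. compliance P (ge x)) \<tau> \<and>
          b_Gam P uf up us \<mu> = 0))"

definition dom_M ::
  "('n::finite) stokes_biot \<Rightarrow> ((real^'n \<Rightarrow> real^'n) \<Rightarrow> real) \<Rightarrow> ((real^'n \<Rightarrow> real^'n) \<Rightarrow> real) \<Rightarrow>
   ((real^'n \<Rightarrow> real) \<Rightarrow> real) \<Rightarrow> ((real^'n \<Rightarrow> real) \<times> (real^'n \<Rightarrow> real^'n^'n)) set" where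
  "dom_M P ff fp qf = {z. \<exists>g. resolvent_system P ff fp qf z g}"

definition op_M ::
  "('n::finite) stokes_biot \<Rightarrow> ((real^'n \<Rightarrow> real^'n) \<Rightarrow> real) \<Rightarrow> ((real^'n \<Rightarrow> real^'n) \<Rightarrow> real) \<Rightarrow>
   ((real^'n \<Rightarrow> real) \<Rightarrow> real) \<Rightarrow> (real^'n \<Rightarrow> real) \<times> (real^'n \<Rightarrow> real^'n^'n) \<Rightarrow>
   ((real^'n \<Rightarrow> real) \<times> (real^'n \<Rightarrow> real^'n^'n)) set" where
  "op_M P ff fp qf = (\<lambda>(pp, \<sigma>).
     {((\<lambda>x. gp x - pp x), (\<lambda>x. ge x - \<sigma> x)) | gp ge. resolvent_system P ff fp qf (pp, \<sigma>) (gp, ge)})"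

(* The inclusion (dp, de) + M(pp, sigma) \<ni> (hp, he) at one instant.  Its first component is an
   identity in the dual of Wp, where h_p lives (as a functional) and into which L^r and L^2 of
   Om_p embed by w \<mapsto> (m, w); its second component is an identity in Sigma_e2. *)
definition evolution_inclusion ::
  "('n::finite) stokes_biot \<Rightarrow> ((real^'n \<Rightarrow> real^'n) \<Rightarrow> real) \<Rightarrow> ((real^'n \<Rightarrow> real^'n) \<Rightarrow> real) \<Rightarrow>
   ((real^'n \<Rightarrow> real) \<Rightarrow> real) \<Rightarrow> ((real^'n \<Rightarrow> real) \<Rightarrow> real) \<Rightarrow> (real^'n \<Rightarrow> real^'n^'n) \<Rightarrow>
   (real^'n \<Rightarrow> real) \<times> (real^'n \<Rightarrow> real^'n^'n) \<Rightarrow>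
   (real^'n \<Rightarrow> real) \<times> (real^'n \<Rightarrow> real^'n^'n) \<Rightarrow> bool" where
  "evolution_inclusion P ff fp qf hp he z = (\<lambda>(dp, de).
     \<exists>(mp, me) \<in> op_M P ff fp qf z.
       (\<forall>w \<in> Wp P. ip (Om_p P) (\<lambda>x. dp x + mp x) w = hp w) \<and>
       (AE x in lebesgue_on (Om_p P). de x + me x = he x))"

(* pp and sigma are W^{1,1} in time with values in the dual spaces of Wp and Sigma_e2, into which
   they embed by the inner products (s0 . , . ) and (A . , . ); their time derivatives are
   represented by the functions dp(t) in L^r, the dual of Wp, and de(t) in Sigma_e2. *)
definition has_time_derivative ::
  "('n::finite) stokes_biot \<Rightarrow> real \<Rightarrow> (real \<Rightarrow> real^'n \<Rightarrow> real) \<Rightarrow> (real \<Rightarrow> real^'n \<Rightarrow> real^'n^'n) \<Rightarrow>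
   (real \<Rightarrow> real^'n \<Rightarrow> real) \<Rightarrow> (real \<Rightarrow> real^'n \<Rightarrow> real^'n^'n) \<Rightarrow> bool" where
  "has_time_derivative P T pp \<sigma> dp de \<longleftrightarrow>
     (AE t in lebesgue_on {0<..<T}.
        dp t \<in> Lp (lebesgue_on (Om_p P)) (r_exp P) \<and> de t \<in> Sigma_e2 P) \<and>
     has_time_derivative_dual T (Wp P) (Wp_norm P)
       (\<lambda>t w. ip (Om_p P) (\<lambda>x. s0 P * pp t x) w) (\<lambda>t w. ip (Om_p P) (\<lambda>x. s0 P * dp t x) w) \<and>
     has_time_derivative_dual T (Sigma_e2 P) (Sigma_e2_norm P)
       (\<lambda>t \<tau>. ip (Om_p P) (\<lambda>x. compliance P (\<sigma> t x)) \<tau>)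
       (\<lambda>t \<tau>. ip (Om_p P) (\<lambda>x. compliance P (de t x)) \<tau>)"

end

theory Submission
  imports Defs
begin

text \<open>At almost every time, resolve the inclusion: some solution of the resolvent system for data
  \<open>(g\<^sub>p, g\<^sub>e)\<close> satisfies \<open>\<partial>\<^sub>t p + g\<^sub>p - p = h\<^sub>p\<close> and \<open>\<partial>\<^sub>t \<sigma> + g\<^sub>e - \<sigma> = 0\<close>.  Testing with \<open>s\<^sub>0 w\<^sub>p\<close> and
  \<open>A \<tau>\<close> and substituting for \<open>(g\<^sub>p, g\<^sub>e)\<close> cancels \<open>p\<close> and \<open>\<sigma>\<close> from the second equation and leaves the
  time derivatives.\<close>

text \<open>Cauchy-Schwarz followed by Young's inequality dominates the integrand by
  \<open>norm (f x) powr p / p + norm (g x) powr q / q\<close>. Integrability is all that splitting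
  the tested identities requires, so no norm bound is derived.\<close>

lemma Lp_inner_integrable:
  fixes f g :: "'a \<Rightarrow> 'b::euclidean_space"
  assumes "f \<in> Lp M p" "g \<in> Lp M q" "p > 1" "1 / p + 1 / q = 1"
  shows "integrable M (\<lambda>x. f x \<bullet> g x)"
proof (rule Bochner_Integration.integrable_bound)
  have "0 < 1 / p" "1 / p < 1" using assms(3) by auto
  then have "0 < 1 / q" "1 / q < 1" using assms(4) by linarith+
  then have q: "q > 1" by (simp add: divide_less_eq_1_pos)
  show "integrable M (\<lambda>x. norm (f x) powr p / p + norm (g x) powr q / q)"
    using assms by (auto simp: Lp_def)
  show "(\<lambda>x. f x \<bullet> g x) \<in> borel_measurable M"
    using assms by (auto simp: Lp_def)
  have "norm (f x \<bullet> g x) \<le> norm (norm (f x) powr p / p + norm (g x) powr q / q)" for x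
  proof -
    have "\<bar>f x \<bullet> g x\<bar> \<le> norm (f x) * norm (g x)"
      by (rule Cauchy_Schwarz_ineq2)
    also have "\<dots> \<le> norm (f x) powr p / p + norm (g x) powr q / q"
      using assms q by (intro Youngs_inequality) auto
    finally show ?thesis by simp
  qed
  then show "AE x in M. norm (f x \<bullet> g x) \<le> norm (norm (f x) powr p / p + norm (g x) powr q / q)"
    by simp
qed

text \<open>Pointwise a^p \<le> 1 + a^q, by comparing a with 1; the constant 1 is integrable because
  the measure is finite.\<close>

lemma Lp_mono_finite_measure:
  fixes f :: "'a \<Rightarrow> 'b::euclidean_space"
  assumes "finite_measure M" "f \<in> Lp M q" "0 \<le> p" "p \<le> q"
  shows "f \<in> Lp M p"
proof -
  interpret finite_measure M by fact
  have "integrable M (\<lambda>x. norm (f x) powr p)"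
  proof (rule Bochner_Integration.integrable_bound)
    show "integrable M (\<lambda>x. 1 + norm (f x) powr q)"
      using assms by (auto simp: Lp_def)
    show "(\<lambda>x. norm (f x) powr p) \<in> borel_measurable M"
      using assms by (auto simp: Lp_def)
    have "norm (f x) powr p \<le> 1 + norm (f x) powr q" for x
    proof (cases "norm (f x) \<le> 1")
      case True
      then have "norm (f x) powr p \<le> 1"
        using assms(3) by (simp add: powr_le1)
      then show ?thesis by (smt (verit) powr_ge_zero)
    next
      case False
      then show ?thesis using powr_mono[OF assms(4), of "norm (f x)"] by linarith
    qed
    then show "AE x in M. norm (norm (f x) powr p) \<le> norm (1 + norm (f x) powr q)"
      by (simp add: add_nonneg_nonneg)
  qed
  then show ?thesis using assms(2) by (simp add: Lp_def)
qed

text \<open>An operator bound K gives the integrable majorant K^p |f|^p. This serves to keep A\<rho>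
  in L^2 for every \<rho> in L^2.\<close>

lemma Lp_bounded_linear:
  fixes f :: "'a \<Rightarrow> 'b::euclidean_space" and L :: "'b \<Rightarrow> 'c::euclidean_space"
  assumes "bounded_linear L" "f \<in> Lp M p" "0 \<le> p"
  shows "(\<lambda>x. L (f x)) \<in> Lp M p"
proof -
  obtain K where K: "K > 0" "\<And>y. norm (L y) \<le> norm y * K"
    using bounded_linear.pos_bounded[OF assms(1)] by blast
  have meas: "(\<lambda>x. L (f x)) \<in> borel_measurable M"
    using assms linear_continuous_on[OF assms(1), of UNIV]
    by (auto simp: Lp_def intro: borel_measurable_continuous_on)
  have "integrable M (\<lambda>x. norm (L (f x)) powr p)"
  proof (rule Bochner_Integration.integrable_bound)
    show "integrable M (\<lambda>x. K powr p * norm (f x) powr p)"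
      using assms by (auto simp: Lp_def)
    show "(\<lambda>x. norm (L (f x)) powr p) \<in> borel_measurable M"
      using meas by simp
    have "norm (L y) powr p \<le> K powr p * norm y powr p" for y
      using powr_mono2[OF assms(3) norm_ge_zero K(2)[of y]] K(1)
      by (simp add: powr_mult mult.commute)
    then show "AE x in M. norm (norm (L (f x)) powr p) \<le> norm (K powr p * norm (f x) powr p)"
      by simp
  qed
  with meas show ?thesis by (simp add: Lp_def)
qed

lemma linear_compliance: "linear (compliance P)"
  by (rule linearI)
    (simp_all add: compliance_def trace_add trace_def sum_distrib_left algebra_simps sum.distrib scaleR_right.sum)

text \<open>The region inherits boundedness from the Lipschitz domain that contains it.\<close>

lemma finite_measure_Om_p:
  assumes "geometry \<Omega> P"
  shows "finite_measure (lebesgue_on (Om_p P))"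
proof -
  have "bounded (Om_p P)" "open (Om_p P)"
    using assms by (auto simp: geometry_def lipschitz_domain_def intro: bounded_subset)
  then have "Om_p P \<in> lmeasurable"
    by (intro lmeasurable_open)
  then show ?thesis by (rule finite_measure_lebesgue_on)
qed

text \<open>The whole argument at one frozen instant: time enters only through the values
  \<open>dp\<close> and \<open>de\<close>, of which just their spatial integrability is
  used.\<close>

lemma evolution_inclusion_system:
  assumes geometry: "geometry \<Omega> P" and parameters: "parameters P"
    and dp: "dp \<in> Lp (lebesgue_on (Om_p P)) (r_exp P)" and de: "de \<in> Sigma_e2 P"
    and evol: "evolution_inclusion P ff fp qf (\<lambda>w. inverse (s0 P) * qp w) (\<lambda>x. 0) (pp, \<sigma>) (dp, de)"
  shows "\<exists>uf \<in> Vf P. \<exists>pf \<in> Wf P. \<exists>up \<in> Vp P. \<exists>us \<in> Xp P. \<exists>lam \<in> Lam P.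
      \<forall>vf \<in> Vf P. \<forall>wf \<in> Wf P. \<forall>vp \<in> Vp P. \<forall>wp \<in> Wp P. \<forall>vs \<in> Xp P. \<forall>\<tau> \<in> Sigma_e P. \<forall>\<mu> \<in> Lam P.
        a_f P uf vf + a_pd P up vp + a_BJS P uf us vf vs + b_f P vf pf + b_p P vp pp
          + alpha_p P * b_p P vs pp + b_s P vs \<sigma> + b_Gam P vf vp vs lam
          = ff vf + fp vs \<and>
        ip (Om_p P) (\<lambda>x. s0 P * dp x) wp + a_ps P de \<tau> - alpha_p P * b_p P us wp
          - b_p P up wp - b_s P us \<tau> - b_f P uf wf
          = qf wf + qp wp \<and>
        b_Gam P uf up us \<mu> = 0"
proof -
  let ?M = "lebesgue_on (Om_p P)"
  obtain gp ge where sys: "resolvent_system P ff fp qf (pp, \<sigma>) (gp, ge)"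
    and hp: "\<And>w. w \<in> Wp P \<Longrightarrow> ip (Om_p P) (\<lambda>x. dp x + (gp x - pp x)) w = inverse (s0 P) * qp w"
    and he: "AE x in ?M. de x + (ge x - \<sigma> x) = 0"
    using evol unfolding evolution_inclusion_def op_M_def by auto
  have fin: "finite_measure ?M" by (rule finite_measure_Om_p[OF geometry])
  have r: "1 < r_exp P" "1 / r_exp P + 1 / r_conj P = 1" "s0 P > 0" "r_exp P < 2"
    using parameters by (auto simp: parameters_def)
  \<comment> \<open>Since r < 2, the conjugate exponent exceeds 2. Hence \<open>Wp P\<close> embeds
    into L^2, and pairings of test functions with \<open>gp\<close>, which is only in L^2, are
    integrable.\<close>
  have "1 / 2 < 1 / r_exp P" "1 / r_exp P < 1"
    using r by (auto simp: field_simps)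
  then have "1 / r_conj P < 1 / 2" "0 < 1 / r_conj P"
    using r(2) by linarith+
  then have r2: "2 \<le> r_conj P"
    by (simp add: pos_divide_less_eq)
  have in_L2: "pp \<in> Lp ?M 2" "gp \<in> Lp ?M 2" "\<sigma> \<in> Lp ?M 2" "ge \<in> Lp ?M 2"
    using sys Lp_mono_finite_measure[OF fin _ _ r2]
    by (auto simp: resolvent_system_def Wp_def Wp2_def Sigma_e_def)
  have pressure: "ip (Om_p P) (\<lambda>x. s0 P * dp x) w + ip (Om_p P) (\<lambda>x. s0 P * gp x) w
      = ip (Om_p P) (\<lambda>x. s0 P * pp x) w + qp w" if w: "w \<in> Wp P" for w
  proof -
    have w2: "w \<in> Lp ?M 2"
      using w Lp_mono_finite_measure[OF fin _ _ r2] by (auto simp: Wp_def)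
    \<comment> \<open>Two dualities are at work: \<open>dp\<close> in L^r is paired with
      \<open>w\<close> in its conjugate space, whereas \<open>gp\<close> and \<open>pp\<close> are
      paired with \<open>w\<close> in L^2.\<close>
    have int: "integrable ?M (\<lambda>x. dp x * w x)" "integrable ?M (\<lambda>x. gp x * w x)"
      "integrable ?M (\<lambda>x. pp x * w x)"
      using Lp_inner_integrable[OF dp _ r(1,2), of w] Lp_inner_integrable[OF in_L2(2) w2]
        Lp_inner_integrable[OF in_L2(1) w2] w by (auto simp: Wp_def)
    then have "ip (Om_p P) (\<lambda>x. dp x + (gp x - pp x)) w
        = ip (Om_p P) dp w + ip (Om_p P) gp w - ip (Om_p P) pp w"
      by (simp add: ip_def algebra_simps)
    with hp[OF w] have "ip (Om_p P) dp w + ip (Om_p P) gp w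
        = ip (Om_p P) pp w + inverse (s0 P) * qp w"
      by simp
    \<comment> \<open>Multiplying by the positive constant \<open>s0 P\<close> removes the inverse
      in the source and produces the weights of the second equation.\<close>
    then have "s0 P * (ip (Om_p P) dp w + ip (Om_p P) gp w)
        = s0 P * (ip (Om_p P) pp w + inverse (s0 P) * qp w)"
      by simp
    with r(3) show ?thesis
      by (simp add: ip_def mult.assoc distrib_left)
  qed
  have stress: "a_ps P de \<tau> + a_ps P ge \<tau> = a_ps P \<sigma> \<tau>" if "\<tau> \<in> Sigma_e P" for \<tau>
  proof -
    have int: "integrable ?M (\<lambda>x. compliance P (\<rho> x) \<bullet> \<tau> x)" if "\<rho> \<in> Lp ?M 2" for \<rho>
      using Lp_inner_integrable[OF Lp_bounded_linear[OF _ that], of "compliance P" \<tau> 2]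
        linear_compliance \<open>\<tau> \<in> Sigma_e P\<close>
      by (auto simp: linear_conv_bounded_linear Sigma_e_def)
    have "a_ps P de \<tau> + a_ps P ge \<tau>
        = (\<integral>x. compliance P (de x) \<bullet> \<tau> x + compliance P (ge x) \<bullet> \<tau> x \<partial>?M)"
      using int in_L2(4) de by (simp add: a_ps_def ip_def Sigma_e_def)
    also have "\<dots> = (\<integral>x. compliance P (de x + ge x) \<bullet> \<tau> x \<partial>?M)"
      by (simp add: linear_add[OF linear_compliance] inner_add_left)
    \<comment> \<open>Here the second component of the inclusion enters: its source is 0, so
      \<open>de + ge\<close> equals \<sigma> almost everywhere.\<close>
    also have "\<dots> = a_ps P \<sigma> \<tau>"
      unfolding a_ps_def ip_def
    proof (rule integral_cong_AE)
      have "(\<lambda>x. compliance P (de x) \<bullet> \<tau> x + compliance P (ge x) \<bullet> \<tau> x) \<in> borel_measurable ?M"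
        using int[of de] int[of ge] in_L2(4) de
        by (intro borel_measurable_add borel_measurable_integrable) (auto simp: Sigma_e_def)
      then show "(\<lambda>x. compliance P (de x + ge x) \<bullet> \<tau> x) \<in> borel_measurable ?M"
        by (simp add: linear_add[OF linear_compliance] inner_add_left)
      show "(\<lambda>x. compliance P (\<sigma> x) \<bullet> \<tau> x) \<in> borel_measurable ?M"
        using int[OF in_L2(3)] by simp
      show "AE x in ?M. compliance P (de x + ge x) \<bullet> \<tau> x = compliance P (\<sigma> x) \<bullet> \<tau> x"
        using he by eventually_elim (simp add: add_diff_eq)
    qed
    finally show ?thesis .
  qed
  obtain up us uf pf lam where mem: "up \<in> Vp P" "us \<in> Xp P" "uf \<in> Vf P" "pf \<in> Wf P" "lam \<in> Lam P"
    and eqs: "\<forall>vp \<in> Vp P. \<forall>vs \<in> Xp P. \<forall>vf \<in> Vf P. \<forall>wp \<in> Wp P. \<forall>\<tau> \<in> Sigma_e P. \<forall>wf \<in> Wf P. \<forall>\<mu> \<in> Lam P.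
          a_f P uf vf + a_pd P up vp + a_BJS P uf us vf vs + b_f P vf pf + b_p P vp pp
            + alpha_p P * b_p P vs pp + b_s P vs \<sigma> + b_Gam P vf vp vs lam
            = ff vf + fp vs \<and>
          ip (Om_p P) (\<lambda>x. s0 P * pp x) wp + a_ps P \<sigma> \<tau> - alpha_p P * b_p P us wp - b_p P up wp
            - b_s P us \<tau> - b_f P uf wf
            = qf wf + ip (Om_p P) (\<lambda>x. s0 P * gp x) wp + a_ps P ge \<tau> \<and>
          b_Gam P uf up us \<mu> = 0"
    using sys unfolding resolvent_system_def prod.case a_ps_def by blast
  show ?thesis
  proof (rule bexI[OF _ mem(3)], rule bexI[OF _ mem(4)], rule bexI[OF _ mem(1)],
      rule bexI[OF _ mem(2)], rule bexI[OF _ mem(5)], intro ballI, goal_cases)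
    case (1 vf wf vp wp vs \<tau> \<mu>)
    \<comment> \<open>Subtracting \<open>pressure\<close> and \<open>stress\<close> from the second
      equation replaces \<open>pp\<close> by \<open>dp\<close> and \<sigma> by \<open>de\<close> on
      the left, cancels \<open>gp\<close> and \<open>ge\<close> on the right and leaves
      \<open>qp wp\<close>. The first and third equations carry over unchanged.\<close>
    with eqs[rule_format, of vp vs vf wp \<tau> wf \<mu>] pressure[of wp] stress[of \<tau>]
    show ?case by simp
  qed
qed

theorem lemma4p9:
  fixes P :: "('n::finite) stokes_biot" and \<Omega> :: "(real^'n) set" and T :: real
    and f_f f_p :: "real \<Rightarrow> (real^'n \<Rightarrow> real^'n) \<Rightarrow> real"
    and q_f q_p :: "real \<Rightarrow> (real^'n \<Rightarrow> real) \<Rightarrow> real"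
    and p_p dt_p :: "real \<Rightarrow> real^'n \<Rightarrow> real"
    and \<sigma> dt_\<sigma> :: "real \<Rightarrow> real^'n \<Rightarrow> real^'n^'n"
    and h_p :: "real \<Rightarrow> (real^'n \<Rightarrow> real) \<Rightarrow> real"
    and h_e :: "real \<Rightarrow> real^'n \<Rightarrow> real^'n^'n"
  assumes geometry: "geometry \<Omega> P"
    and parameters: "parameters P"
    and T: "T > 0"
    and f_f: "W11_dual T (Vf P) (Vf_norm P) f_f"
    and f_p: "W11_dual T (Xp P) (Xp_norm P) f_p"
    and q_f: "W11_dual T (Wf P) (Wf_norm P) q_f"
    and q_p: "W11_dual T (Wp P) (Wp_norm P) q_p"
    and h_p: "h_p = (\<lambda>t w. inverse (s0 P) * q_p t w)"
    and h_e: "h_e = (\<lambda>t x. 0)"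
    and deriv: "has_time_derivative P T p_p \<sigma> dt_p dt_\<sigma>"
    and dom: "AE t in lebesgue_on {0<..<T}. (p_p t, \<sigma> t) \<in> dom_M P (f_f t) (f_p t) (q_f t)"
    and evol: "AE t in lebesgue_on {0<..<T}.
      evolution_inclusion P (f_f t) (f_p t) (q_f t) (h_p t) (h_e t) (p_p t, \<sigma> t) (dt_p t, dt_\<sigma> t)"
  shows "AE t in lebesgue_on {0<..<T}.
    \<exists>u_f \<in> Vf P. \<exists>p_f \<in> Wf P. \<exists>u_p \<in> Vp P. \<exists>u_s \<in> Xp P. \<exists>lam \<in> Lam P.
      \<forall>v_f \<in> Vf P. \<forall>w_f \<in> Wf P. \<forall>v_p \<in> Vp P. \<forall>w_p \<in> Wp P. \<forall>v_s \<in> Xp P. \<forall>\<tau> \<in> Sigma_e P. \<forall>\<mu> \<in> Lam P.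
        a_f P u_f v_f + a_pd P u_p v_p + a_BJS P u_f u_s v_f v_s + b_f P v_f p_f + b_p P v_p (p_p t)
          + alpha_p P * b_p P v_s (p_p t) + b_s P v_s (\<sigma> t) + b_Gam P v_f v_p v_s lam
          = f_f t v_f + f_p t v_s \<and>
        ip (Om_p P) (\<lambda>x. s0 P * dt_p t x) w_p + a_ps P (dt_\<sigma> t) \<tau> - alpha_p P * b_p P u_s w_p
          - b_p P u_p w_p - b_s P u_s \<tau> - b_f P u_f w_f
          = q_f t w_f + q_p t w_p \<and>
        b_Gam P u_f u_p u_s \<mu> = 0"
proof -
  \<comment> \<open>The exceptional times for the regularity of the derivatives and for the
    inclusion are both null sets; outside their union the instantaneous result applies.\<close>
  have "AE t in lebesgue_on {0<..<T}.
      dt_p t \<in> Lp (lebesgue_on (Om_p P)) (r_exp P) \<and> dt_\<sigma> t \<in> Sigma_e2 P"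
    using deriv by (simp add: has_time_derivative_def)
  then show ?thesis
    using evol
    by eventually_elim
      (rule evolution_inclusion_system[OF geometry parameters], simp_all add: h_p h_e)
qed

end
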